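(* Let $(\boldsymbol v,C)$ be admissible and $A=C-\boldsymbol v\boldsymbol v^{\mathrm T}$. Among matrices of the block form $\begin{pmatrix}p&\boldsymbol q^{\mathrm T}\\0&S\end{pmatrix}$ with $p>0$ and $S$ symmetric positive definite there is exactly one, denoted $w_3(\boldsymbol v,C)$, such that $w_3\,Q(\boldsymbol v,C)\,w_3^{\mathrm T}=Q_*$, namely the one with $$S=c\,A^{-1/2},\qquad \boldsymbol q=p\,A^{-1}\boldsymbol v,\qquad p=\bigl(1+\boldsymbol v^{\mathrm T}A^{-1}\boldsymbol v\bigr)^{-1/2}.$$ For the classical medium $(\boldsymbol v,c^2I)$ with $|\boldsymbol v|<c$, $w_3(\boldsymbol v,c^2I)=w(\boldsymbol v)$.
   Context: Fix $c>0$ and $d\in\{2,3\}$. A pair $(\boldsymbol v,C)$ with $\boldsymbol v\in\mathbb R^d$ and $C$ a real symmetric $d\times d$ matrix is admissible if $A=C-\boldsymbol v\boldsymbol v^{\mathrm T}$ is positive definite. $Q(\boldsymbol v,C)=\begin{pmatrix}1&\boldsymbol v^{\mathrm T}\\ \boldsymbol v&\boldsymbol v\boldsymbol v^{\mathrm T}-C\end{pmatrix}$, $Q_*=\begin{pmatrix}1&0\\0&-c^2I\end{pmatrix}$. For $|\boldsymbol v|<c$, $\gamma=(1-|\boldsymbol v|^2/c^2)^{-1/2}$, $\hat{\boldsymbol v}=\boldsymbol v/|\boldsymbol v|$ (terms containing $\hat{\boldsymbol v}$ read as $0$ if $\boldsymbol v=0$): $g(\boldsymbol v):(t,\boldsymbol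 x)\mapsto(t,\boldsymbol x-\boldsymbol vt)$, $\ell(\boldsymbol v):(t,\boldsymbol x)\mapsto\bigl(\gamma(t-\boldsymbol v\cdot\boldsymbol x/c^2),\ \boldsymbol x+(\gamma-1)(\hat{\boldsymbol v}\cdot\boldsymbol x)\hat{\boldsymbol v}-\gamma\boldsymbol vt\bigr)$, and $w(\boldsymbol v)=\ell(-\boldsymbol v)\,g(\boldsymbol v)$, as matrices acting on $(t,\boldsymbol x)$. *)

theory Defs
  imports "HOL-Analysis.Analysis"
begin

(* Space-time R x R^d is real ^ ('d option): the index None is the time coordinate t,
   the indices Some i are the space coordinates x_i. *)

definition event :: "real \<Rightarrow> real ^ 'd \<Rightarrow> real ^ ('d::finite option)" where
  "event t x = (\<chi> i. case i of None \<Rightarrow> t | Some k \<Rightarrow> x $ k)"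

definition time_part :: "real ^ ('d::finite option) \<Rightarrow> real" where
  "time_part z = z $ None"

definition space_part :: "real ^ ('d::finite option) \<Rightarrow> real ^ 'd" where
  "space_part z = (\<chi> k. z $ Some k)"

(* The matrix with block rows (p, q^T) and (r, S). *)
definition block :: "real \<Rightarrow> real ^ 'd \<Rightarrow> real ^ 'd \<Rightarrow> real ^ 'd ^ 'd \<Rightarrow> real ^ ('d::finite option) ^ ('d::finite option)" where
  "block p q r S = (\<chi> i j. case i of
      None \<Rightarrow> (case j of None \<Rightarrow> p | Some l \<Rightarrow> q $ l)
    | Some k \<Rightarrow> (case j of None \<Rightarrow> r $ k | Some l \<Rightarrow> S $ k $ l))"

lemma block_mult_event:
  "block p q r S *v event t x = event (p * t + q \<bullet> x) (t *\<^sub>R r + S *v x)"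
proof -
  have sum_option: "sum f UNIV = f None + (\<Sum>k\<in>UNIV. f (Some k))"
    for f :: "'d::finite option \<Rightarrow> real"
    by (simp add: UNIV_option_conv sum.reindex)
  show ?thesis
    by (simp add: vec_eq_iff block_def event_def matrix_vector_mult_def inner_vec_def
        sum_option mult.commute split: option.split)
qed

definition outer :: "real ^ 'd \<Rightarrow> real ^ 'd ^ 'd" where
  "outer v = (columnvector v :: real ^ 1 ^ 'd) ** rowvector v"

lemma outer_nth: "outer v $ i $ j = v $ i * v $ j"
  by (simp add: outer_def matrix_matrix_mult_def columnvector_def rowvector_def)

definition pos_def :: "real ^ 'd ^ 'd \<Rightarrow> bool" where
  "pos_def M \<longleftrightarrow> transpose M = M \<and> (\<forall>x. x \<noteq> 0 \<longrightarrow> 0 < x \<bullet> (M *v x))"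

(* Principal square root; the description is proper only for positive definite M. *)
definition matrix_sqrt :: "real ^ 'd ^ 'd \<Rightarrow> real ^ 'd ^ 'd" where
  "matrix_sqrt M = (THE B. pos_def B \<and> B ** B = M)"

definition admissible :: "real ^ 'd \<Rightarrow> real ^ 'd ^ 'd \<Rightarrow> bool" where
  "admissible v C \<longleftrightarrow> transpose C = C \<and> pos_def (C - outer v)"

definition Qmat :: "real ^ 'd \<Rightarrow> real ^ 'd ^ 'd \<Rightarrow> real ^ ('d::finite option) ^ ('d::finite option)" where
  "Qmat v C = block 1 v v (outer v - C)"

definition Qstar :: "real \<Rightarrow> real ^ ('d::finite option) ^ ('d::finite option)" where
  "Qstar c = block 1 0 0 (- (c\<^sup>2 *\<^sub>R mat 1))"

definition gamma_factor :: "real \<Rightarrow> real ^ 'd \<Rightarrow> real" where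
  "gamma_factor c v = (1 - (norm v)\<^sup>2 / c\<^sup>2) powr (- 1 / 2)"

definition galilei :: "real ^ 'd \<Rightarrow> real ^ ('d::finite option) ^ ('d::finite option)" where
  "galilei v = matrix (\<lambda>z. event (time_part z) (space_part z - time_part z *\<^sub>R v))"

(* sgn v is the unit vector v / |v|, and sgn 0 = 0. *)
definition lorentz :: "real \<Rightarrow> real ^ 'd \<Rightarrow> real ^ ('d::finite option) ^ ('d::finite option)" where
  "lorentz c v = matrix (\<lambda>z.
     let t = time_part z; x = space_part z; \<gamma> = gamma_factor c v in
     event (\<gamma> * (t - (v \<bullet> x) / c\<^sup>2))
           (x + ((\<gamma> - 1) * (sgn v \<bullet> x)) *\<^sub>R sgn v - (\<gamma> * t) *\<^sub>R v))"

lemma galilei_mult_event: "galilei v *v event t x = event t (x - t *\<^sub>R v)"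
proof -
  have "linear (\<lambda>z. event (time_part z) (space_part z - time_part z *\<^sub>R v))"
    by (rule linearI) (simp_all add: vec_eq_iff event_def time_part_def space_part_def
        algebra_simps split: option.split)
  then show ?thesis
    by (simp add: galilei_def event_def time_part_def space_part_def)
qed

lemma lorentz_mult_event:
  "lorentz c v *v event t x =
     event (gamma_factor c v * (t - (v \<bullet> x) / c\<^sup>2))
           (x + ((gamma_factor c v - 1) * (sgn v \<bullet> x)) *\<^sub>R sgn v - (gamma_factor c v * t) *\<^sub>R v)"
proof -
  have sp: "space_part (a + b) = space_part a + space_part b"
    "space_part (r *\<^sub>R a) = r *\<^sub>R space_part a" for a b :: "real ^ ('d::finite option)" and r
    by (simp_all add: space_part_def vec_eq_iff)
  have "linear (\<lambda>z. let t = time_part z; x = space_part z; \<gamma> = gamma_factor c v in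
     event (\<gamma> * (t - (v \<bullet> x) / c\<^sup>2))
           (x + ((\<gamma> - 1) * (sgn v \<bullet> x)) *\<^sub>R sgn v - (\<gamma> * t) *\<^sub>R v))"
    by (rule linearI) (simp_all add: Let_def sp inner_add_right vec_eq_iff event_def time_part_def
        algebra_simps add_divide_distrib diff_divide_distrib split: option.split)
  then show ?thesis
    by (simp add: lorentz_def Let_def event_def time_part_def space_part_def)
qed

definition w_transf :: "real \<Rightarrow> real ^ 'd \<Rightarrow> real ^ ('d::finite option) ^ ('d::finite option)" where
  "w_transf c v = lorentz c (- v) ** galilei v"

definition is_w3 :: "real \<Rightarrow> real ^ 'd \<Rightarrow> real ^ 'd ^ 'd \<Rightarrow> real ^ ('d::finite option) ^ ('d::finite option) \<Rightarrow> bool" where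
  "is_w3 c v C W \<longleftrightarrow>
     (\<exists>p q S. W = block p q 0 S \<and> 0 < p \<and> pos_def S) \<and>
     W ** Qmat v C ** transpose W = Qstar c"

definition w3 :: "real \<Rightarrow> real ^ 'd \<Rightarrow> real ^ 'd ^ 'd \<Rightarrow> real ^ ('d::finite option) ^ ('d::finite option)" where
  "w3 c v C = (THE W. is_w3 c v C W)"

end

theory Submission
  imports Defs
begin

text \<open>
  With \<open>W\<close> the block matrix of \<open>p\<close>, \<open>q\<close>, \<open>0\<close>, \<open>S\<close>, the product \<open>W Q W\<^sup>T\<close> has the lower right
  block \<open>- S A S\<close>, the off-diagonal block \<open>S (p v - A q)\<close> and, once the latter vanishes, the upper
  left entry \<open>p\<^sup>2 + p q \<bullet> v\<close>. So \<open>W Q W\<^sup>T = Q\<^sub>*\<close> splits into \<open>S A S = c\<^sup>2\<close>, which uniqueness of the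
  positive definite square root solves for \<open>S\<close>, and \<open>A q = p v\<close>, \<open>p\<^sup>2 + p q \<bullet> v = 1\<close>, which determine
  \<open>q\<close> and \<open>p > 0\<close>. For the classical medium, \<open>\<ell>(- v) g(v)\<close> turns out to have this block form with
  \<open>p = 1 / \<gamma>\<close>, \<open>q = (\<gamma> / c\<^sup>2) v\<close> and \<open>S = 1 + (\<gamma> - 1) v\<^sub>0 v\<^sub>0\<^sup>T\<close>, \<open>v\<^sub>0 = v / |v|\<close>, and to satisfy
  these three equations.
\<close>

section \<open>Positive definite matrices\<close>

lemma pos_def_sym: "pos_def A \<Longrightarrow> transpose A = A"
  by (simp add: pos_def_def)

lemma pos_def_pos: "pos_def A \<Longrightarrow> x \<noteq> 0 \<Longrightarrow> 0 < x \<bullet> (A *v x)"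
  by (simp add: pos_def_def)

lemma pos_def_nonneg: "pos_def A \<Longrightarrow> 0 \<le> x \<bullet> (A *v x)"
  by (cases "x = 0") (auto simp: pos_def_def less_imp_le)

lemma symmetric_inner_swap:
  fixes A :: "real ^ 'd ^ 'd"
  assumes "transpose A = A"
  shows "(A *v x) \<bullet> y = x \<bullet> (A *v y)"
  by (subst assms[symmetric]) (simp add: dot_lmul_matrix)

text \<open>Reduces symmetry to self-adjointness, the convenient form for matrices known only
  through their action on vectors: inverses, the root built below from an operator, the space block
  of \<open>w_transf\<close>.\<close>

lemma transpose_eq_selfI:
  fixes A :: "real ^ 'd ^ 'd"
  assumes "\<And>x y. (A *v x) \<bullet> y = x \<bullet> (A *v y)"
  shows "transpose A = A"
proof -
  have "x \<bullet> (transpose A *v y) = x \<bullet> (A *v y)" for x y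
    using dot_lmul_matrix[of y A x] assms[of x y] by (simp add: inner_commute)
  then have "transpose A *v y = A *v y" for y
    using vector_eq_ldot[of "transpose A *v y" "A *v y"] by blast
  then show ?thesis
    by (simp add: matrix_eq)
qed

lemma pos_def_invertible:
  assumes "pos_def (A :: real ^ 'd ^ 'd)"
  shows "invertible A"
proof -
  have "x = 0" if "A *v x = 0" for x
    using pos_def_pos[OF assms, of x] that by (cases "x = 0") simp_all
  then show ?thesis
    by (auto simp: invertible_left_inverse matrix_left_invertible_ker)
qed

lemma matrix_inv_mult:
  assumes "invertible (A :: real ^ 'd ^ 'd)"
  shows "A ** matrix_inv A = mat 1" "matrix_inv A ** A = mat 1"
  using assms unfolding invertible_def matrix_inv_def
  by (metis (mono_tags, lifting) someI_ex)+

lemma matrix_inv_mult_vector: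
  assumes "invertible (A :: real ^ 'd ^ 'd)"
  shows "A *v (matrix_inv A *v x) = x" "matrix_inv A *v (A *v x) = x"
  by (simp_all add: matrix_vector_mul_assoc matrix_inv_mult[OF assms])

text \<open>Substituting \<open>y = matrix_inv A *v x\<close> turns the quadratic form of the
  inverse at \<open>x\<close> into that of \<open>A\<close> at \<open>y\<close>.\<close>

lemma pos_def_matrix_inv:
  assumes "pos_def (A :: real ^ 'd ^ 'd)"
  shows "pos_def (matrix_inv A)"
  unfolding pos_def_def
proof (intro conjI allI impI transpose_eq_selfI)
  note inv = matrix_inv_mult_vector[OF pos_def_invertible[OF assms]]
  fix x y :: "real ^ 'd"
  show "(matrix_inv A *v x) \<bullet> y = x \<bullet> (matrix_inv A *v y)"
    using symmetric_inner_swap[OF pos_def_sym[OF assms], of "matrix_inv A *v x" "matrix_inv A *v y"]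
    by (simp add: inv)
  assume "x \<noteq> 0"
  then have "matrix_inv A *v x \<noteq> 0"
    by (metis inv(1) matrix_vector_mult_0_right)
  then show "0 < x \<bullet> (matrix_inv A *v x)"
    using pos_def_pos[OF assms, of "matrix_inv A *v x"] by (simp add: inv inner_commute)
qed

lemma pos_def_scaleR: "pos_def A \<Longrightarrow> 0 < k \<Longrightarrow> pos_def (k *\<^sub>R A)"
  by (auto simp: pos_def_def transpose_def vec_eq_iff scaleR_matrix_vector_assoc[symmetric])

text \<open>The quadratic form attains a positive minimum on the compact unit sphere, and
  homogeneity extends the bound to all vectors. This bound is what makes the iteration for the
  square root contract.\<close>

lemma pos_def_coercive:
  assumes "pos_def (A :: real ^ 'd ^ 'd)"
  shows "\<exists>m>0. \<forall>x. m * (norm x)\<^sup>2 \<le> x \<bullet> (A *v x)"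
proof -
  have "continuous_on (sphere 0 1) (\<lambda>x. x \<bullet> (A *v x))"
    by (intro continuous_intros linear_continuous_on) simp
  moreover have "sphere (0 :: real ^ 'd) 1 \<noteq> {}"
    by simp
  ultimately have "\<exists>u\<in>sphere 0 1. \<forall>x\<in>sphere 0 1. u \<bullet> (A *v u) \<le> x \<bullet> (A *v x)"
    by (intro continuous_attains_inf compact_sphere)
  then obtain u where u: "norm u = 1" "\<And>x. norm x = 1 \<Longrightarrow> u \<bullet> (A *v u) \<le> x \<bullet> (A *v x)"
    by auto
  show ?thesis
  proof (intro exI conjI allI)
    show "0 < u \<bullet> (A *v u)"
      using u(1) by (intro pos_def_pos[OF assms]) auto
    fix x :: "real ^ 'd"
    show "u \<bullet> (A *v u) * (norm x)\<^sup>2 \<le> x \<bullet> (A *v x)"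
    proof (cases "x = 0")
      case False
      have "u \<bullet> (A *v u) \<le> sgn x \<bullet> (A *v sgn x)"
        using False by (intro u(2)) (simp add: norm_sgn)
      also have "\<dots> = (x \<bullet> (A *v x)) / (norm x)\<^sup>2"
        by (simp add: sgn_div_norm power2_eq_square divide_inverse matrix_vector_mult_scaleR)
      finally show ?thesis
        using False by (simp add: pos_le_divide_eq)
    qed simp
  qed
qed

section \<open>The principal square root\<close>

text \<open>
  After scaling, \<open>A = 1 - M\<close> with operator norm \<open>\<parallel>M\<parallel> \<le> q < 1\<close>. Then \<open>(1 - X)\<^sup>2 = A\<close> reads
  \<open>X = (M + X\<^sup>2) / 2\<close>, and the right hand side is a \<open>q\<close>-contraction of the self-adjoint part of
  the ball of radius \<open>q\<close>.
\<close>

lemma pos_def_sqrt_exists: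
  assumes A: "pos_def (A :: real ^ 'd ^ 'd)"
  shows "\<exists>B. pos_def B \<and> B ** B = A"
proof -
  obtain m where m: "0 < m" "\<And>x. m * (norm x)\<^sup>2 \<le> x \<bullet> (A *v x)"
    using pos_def_coercive[OF A] by blast
  obtain K0 where K0: "0 < K0" "\<And>x. norm (A *v x) \<le> norm x * K0"
    using bounded_linear.pos_bounded[OF matrix_vector_mul_bounded_linear[of A]] by blast
  \<comment> \<open>Adding \<open>m\<close> keeps \<open>K\<close> a bound for the operator norm and
    ensures \<open>m \<le> K\<close>, so that the radicand in \<open>q\<close> is
    nonnegative.\<close>
  define K where "K = K0 + m"
  have K: "0 < K" "m \<le> K" "norm (A *v x) \<le> K * norm x" for x
  proof -
    show "0 < K" "m \<le> K"
      using K0(1) m(1) by (simp_all add: K_def)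
    have "norm x * K0 \<le> norm x * K"
      using m(1) by (intro mult_left_mono) (simp_all add: K_def)
    then show "norm (A *v x) \<le> K * norm x"
      using K0(2)[of x] by (simp add: mult.commute)
  qed
  \<comment> \<open>This value minimizes \<open>1 - 2 * t * m + (t * K)^2\<close>, which bounds the
    squared norm of \<open>1 - t A\<close>; the minimum is the square of \<open>q\<close>
    below.\<close>
  define t where "t = m / K\<^sup>2"
  have tm: "t * m = (m / K)\<^sup>2" "t\<^sup>2 * K\<^sup>2 = (m / K)\<^sup>2"
    using K(1) by (simp_all add: t_def power_divide power2_eq_square)
  define q where "q = sqrt (1 - (m / K)\<^sup>2)"
  have t: "0 < t"
    using m(1) K(1) by (simp add: t_def)
  have mK: "0 < (m / K)\<^sup>2" "(m / K)\<^sup>2 \<le> 1"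
    using m(1) K(1,2) by (simp_all add: power_le_one)
  then have q: "0 \<le> q" "q < 1" "q\<^sup>2 = 1 - (m / K)\<^sup>2"
    by (simp_all add: q_def)
  \<comment> \<open>Bounded linear operators form a complete space under the operator norm, as the
    fixed point theorem requires.\<close>
  define M where "M = Blinfun (\<lambda>x. x - t *\<^sub>R (A *v x))"
  have M: "blinfun_apply M x = x - t *\<^sub>R (A *v x)" for x
  proof -
    have "bounded_linear (\<lambda>x. x - t *\<^sub>R (A *v x))"
      by (intro bounded_linear_sub bounded_linear_ident bounded_linear_const_scaleR
          matrix_vector_mul_bounded_linear)
    then show ?thesis
      unfolding M_def by (simp add: bounded_linear_Blinfun_apply)
  qed
  have "norm M \<le> q"
  proof (rule norm_blinfun_bound[OF q(1)])
    fix x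
    have "(norm (x - t *\<^sub>R (A *v x)))\<^sup>2
        = (norm x)\<^sup>2 - 2 * t * (x \<bullet> (A *v x)) + t\<^sup>2 * (norm (A *v x))\<^sup>2"
      by (simp add: power2_norm_eq_inner inner_diff_left inner_diff_right power2_eq_square[of t]
          inner_commute[of "A *v x" x]) (simp add: algebra_simps)
    also have "\<dots> \<le> (norm x)\<^sup>2 - 2 * t * (m * (norm x)\<^sup>2) + t\<^sup>2 * (K * norm x)\<^sup>2"
      using t by (intro add_mono diff_mono mult_left_mono power_mono m(2) K(3) order_refl
          zero_le_power2 norm_ge_zero) linarith
    also have "\<dots> = (norm x)\<^sup>2 - 2 * (t * m) * (norm x)\<^sup>2 + (t\<^sup>2 * K\<^sup>2) * (norm x)\<^sup>2"
      by (simp add: power_mult_distrib)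
    also have "\<dots> = (q * norm x)\<^sup>2"
      unfolding tm power_mult_distrib q(3) by (simp add: algebra_simps)
    finally show "norm (blinfun_apply M x) \<le> q * norm x"
      unfolding M by (rule power2_le_imp_le) (simp add: q(1))
  qed
  \<comment> \<open>Both conditions pass to the fixed point \<open>X\<close>: self-adjointness makes
    \<open>1 - X\<close> symmetric, and norm at most \<open>q < 1\<close> makes it positive.\<close>
  define S where "S = {X :: (real ^ 'd) \<Rightarrow>\<^sub>L (real ^ 'd).
    norm X \<le> q \<and> (\<forall>x y. blinfun_apply X x \<bullet> y = x \<bullet> blinfun_apply X y)}"
  define f where "f X = (1/2) *\<^sub>R (M + (X o\<^sub>L X))" for X
  have "closed S"
    unfolding S_def
    by (intro closed_Collect_conj closed_Collect_le closed_Collect_all closed_Collect_eq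
        continuous_on_norm continuous_on_inner blinfun.continuous_on continuous_on_id
        continuous_on_const)
  have maps: "f X \<in> S" if X: "X \<in> S" for X
  proof -
    have nX: "norm X \<le> q" and sX: "\<And>x y. X x \<bullet> y = x \<bullet> X y"
      using X by (auto simp: S_def)
    have "norm (X o\<^sub>L X) \<le> q * q"
      using norm_blinfun_compose[of X X] mult_mono[OF nX nX] q(1) by simp
    also have "\<dots> \<le> q"
      using q by (simp add: mult_left_le)
    finally have "norm (f X) \<le> q"
      using norm_triangle_ineq[of M "X o\<^sub>L X"] \<open>norm M \<le> q\<close> by (simp add: f_def)
    moreover have "f X x \<bullet> y = x \<bullet> f X y" for x y
      by (simp add: f_def blinfun.bilinear_simps M sX inner_add_left inner_add_right
          inner_diff_left inner_diff_right symmetric_inner_swap[OF pos_def_sym[OF A]])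
    ultimately show ?thesis
      by (simp add: S_def)
  qed
  have contr: "dist (f X) (f Y) \<le> q * dist X Y" if "X \<in> S" "Y \<in> S" for X Y
  proof -
    have nX: "norm X \<le> q" and nY: "norm Y \<le> q"
      using that by (auto simp: S_def)
    \<comment> \<open>The operators need not commute, so the difference of squares is split as
      \<open>X (X - Y) + (X - Y) Y\<close>.\<close>
    have "f X - f Y = (1/2) *\<^sub>R ((X o\<^sub>L (X - Y)) + ((X - Y) o\<^sub>L Y))"
      by (rule blinfun_eqI) (simp add: f_def blinfun.bilinear_simps algebra_simps)
    then have "norm (f X - f Y) \<le> (norm (X o\<^sub>L (X - Y)) + norm ((X - Y) o\<^sub>L Y)) / 2"
      using norm_triangle_ineq[of "X o\<^sub>L (X - Y)" "(X - Y) o\<^sub>L Y"] by simp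
    also have "\<dots> \<le> (q * norm (X - Y) + norm (X - Y) * q) / 2"
      using norm_blinfun_compose[of X "X - Y"] norm_blinfun_compose[of "X - Y" Y]
        mult_right_mono[OF nX norm_ge_zero[of "X - Y"]] mult_left_mono[OF nY norm_ge_zero[of "X - Y"]]
      by (intro divide_right_mono add_mono) auto
    finally show ?thesis
      by (simp add: dist_norm)
  qed
  have "0 \<in> S"
    using q by (simp add: S_def blinfun.bilinear_simps)
  then have "S \<noteq> {}"
    by auto
  moreover have "complete S" "f ` S \<subseteq> S"
    using \<open>closed S\<close> maps by (auto simp: complete_eq_closed)
  ultimately obtain X where X: "X \<in> S" "f X = X"
    using Banach_fix[of S q f, OF _ _ q(1,2) _ contr] by blast
  have nX: "norm X \<le> q" and sX: "\<And>x y. X x \<bullet> y = x \<bullet> X y"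
    using X by (auto simp: S_def)
  \<comment> \<open>The fixed point equation solved for the square of \<open>X\<close>; it says that
    \<open>1 - X\<close> squares to \<open>t A\<close>.\<close>
  have fix_eq: "X (X x) = 2 *\<^sub>R X x - x + t *\<^sub>R (A *v x)" for x
  proof -
    have "X x = (1/2) *\<^sub>R (x - t *\<^sub>R (A *v x) + X (X x))"
      by (subst X(2)[symmetric]) (simp add: f_def blinfun.bilinear_simps M)
    from arg_cong[OF this, of "scaleR 2"] have "2 *\<^sub>R X x = x - t *\<^sub>R (A *v x) + X (X x)"
      by simp
    then show ?thesis
      by (simp add: algebra_simps)
  qed
  \<comment> \<open>Dividing by \<open>sqrt t\<close> undoes the scaling of
    \<open>A\<close>.\<close>
  define B where "B = matrix (\<lambda>x. (1 / sqrt t) *\<^sub>R (x - X x))"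
  have "linear (\<lambda>x. (1 / sqrt t) *\<^sub>R (x - X x))"
    by (intro linearI) (simp_all add: blinfun.bilinear_simps algebra_simps)
  then have B: "B *v x = (1 / sqrt t) *\<^sub>R (x - X x)" for x
    by (simp add: B_def)
  have "pos_def B"
    unfolding pos_def_def
  proof (intro conjI allI impI transpose_eq_selfI)
    fix x y :: "real ^ 'd"
    show "(B *v x) \<bullet> y = x \<bullet> (B *v y)"
      by (simp add: B inner_diff_left inner_diff_right sX)
    assume "x \<noteq> 0"
    have "x \<bullet> X x \<le> norm x * norm (X x)"
      by (rule norm_cauchy_schwarz)
    also have "\<dots> \<le> norm x * (q * norm x)"
      using norm_blinfun[of X x] mult_right_mono[OF nX norm_ge_zero[of x]]
      by (intro mult_left_mono) auto
    also have "\<dots> < norm x * norm x"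
      using \<open>x \<noteq> 0\<close> q(2) by simp
    finally show "0 < x \<bullet> (B *v x)"
      using t by (simp add: B inner_diff_right power2_norm_eq_inner[unfolded power2_eq_square])
  qed
  moreover have "B ** B = A"
  proof -
    have "B *v (B *v x) = A *v x" for x
    proof -
      have "B *v (B *v x) = (1 / t) *\<^sub>R (x - 2 *\<^sub>R X x + X (X x))"
        using t by (simp add: B blinfun.bilinear_simps scaleR_2 algebra_simps)
      then show ?thesis
        using t by (simp add: fix_eq)
    qed
    then show ?thesis
      by (simp add: matrix_eq matrix_vector_mul_assoc)
  qed
  ultimately show ?thesis
    by blast
qed

text \<open>
  The difference \<open>D\<close> of two roots satisfies \<open>B D + D B' = 0\<close>; multiplying by \<open>D\<^sup>T\<close> and taking the
  trace gives a vanishing sum of nonnegative terms.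
\<close>

lemma pos_def_sqrt_unique:
  fixes B B' :: "real ^ 'd ^ 'd"
  assumes B: "pos_def B" and B': "pos_def B'" and eq: "B ** B = B' ** B'"
  shows "B = B'"
proof (rule ccontr)
  define D where "D = B - B'"
  assume "B \<noteq> B'"
  \<comment> \<open>This column contributes a strictly positive term to the first of the two sums
    below.\<close>
  then obtain k where k: "column k D \<noteq> 0"
    by (auto simp: D_def column_def vec_eq_iff)
  \<comment> \<open>The mixed products cancel and the difference of the two squares remains.\<close>
  have "B ** D + D ** B' = 0"
    by (simp add: matrix_eq D_def matrix_vector_mult_add_rdistrib matrix_vector_mult_diff_rdistrib
        matrix_vector_mult_diff_distrib matrix_vector_mul_assoc[symmetric])
       (simp add: matrix_vector_mul_assoc eq)
  then have "trace (transpose D ** (B ** D) + transpose D ** (D ** B')) = 0"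
    by (simp add: matrix_add_ldistrib[symmetric]) (simp add: trace_def)
  moreover have "trace (transpose D ** (B ** D)) = (\<Sum>j\<in>UNIV. column j D \<bullet> (B *v column j D))"
    by (simp add: trace_def matrix_matrix_mult_def matrix_vector_mult_def transpose_def
        column_def inner_vec_def)
  moreover have "trace (transpose D ** (D ** B')) = (\<Sum>i\<in>UNIV. row i D \<bullet> (B' *v row i D))"
  proof -
    \<comment> \<open>Cyclicity places \<open>B'\<close> between \<open>D\<close> and its transpose,
      which yields quadratic forms of \<open>B'\<close> at the rows of \<open>D\<close>.\<close>
    have "trace (transpose D ** (D ** B')) = trace (D ** (B' ** transpose D))"
      by (metis matrix_mul_assoc trace_mul_sym)
    then show ?thesis
      by (simp add: trace_def matrix_matrix_mult_def matrix_vector_mult_def transpose_def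
        row_def inner_vec_def)
  qed
  moreover have "0 < (\<Sum>j\<in>UNIV. column j D \<bullet> (B *v column j D))"
    by (rule sum_pos2[of _ k]) (auto intro: pos_def_pos[OF B k] pos_def_nonneg[OF B])
  moreover have "0 \<le> (\<Sum>i\<in>UNIV. row i D \<bullet> (B' *v row i D))"
    by (intro sum_nonneg pos_def_nonneg[OF B'])
  ultimately show False
    by (simp add: trace_add)
qed

lemma matrix_sqrt_eqI: "pos_def B \<Longrightarrow> B ** B = A \<Longrightarrow> matrix_sqrt A = B"
  unfolding matrix_sqrt_def by (rule the_equality) (auto intro: pos_def_sqrt_unique)

lemma matrix_sqrt_props:
  assumes "pos_def A"
  shows "pos_def (matrix_sqrt A)" "matrix_sqrt A ** matrix_sqrt A = A"
proof -
  obtain B where B: "pos_def B" "B ** B = A"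
    using pos_def_sqrt_exists[OF assms] by blast
  then show "pos_def (matrix_sqrt A)" "matrix_sqrt A ** matrix_sqrt A = A"
    by (simp_all add: matrix_sqrt_eqI)
qed

text \<open>Multiplying by the inverse of \<open>S\<close> on both sides shows that \<open>c\<close>
  times this inverse squares to \<open>A\<close>. Being positive definite, it is the principal root
  of \<open>A\<close>.\<close>

lemma pos_def_congruence_mat_iff:
  fixes A S :: "real ^ 'd ^ 'd"
  assumes A: "pos_def A" and S: "pos_def S" and c: "0 < c"
  shows "S ** A ** S = c\<^sup>2 *\<^sub>R mat 1 \<longleftrightarrow> S = c *\<^sub>R matrix_inv (matrix_sqrt A)"
proof
  define R where "R = matrix_sqrt A"
  note Si = matrix_inv_mult_vector[OF pos_def_invertible[OF S]]
  assume "S ** A ** S = c\<^sup>2 *\<^sub>R mat 1"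
  then have SAS: "S *v (A *v (S *v x)) = c\<^sup>2 *\<^sub>R x" for x
    by (simp add: matrix_vector_mul_assoc matrix_mul_assoc scaleR_matrix_vector_assoc[symmetric])
  have "A *v x = c\<^sup>2 *\<^sub>R (matrix_inv S *v (matrix_inv S *v x))" for x
    by (metis SAS Si matrix_vector_mult_scaleR)
  then have "(c *\<^sub>R matrix_inv S) ** (c *\<^sub>R matrix_inv S) = A"
    by (simp add: matrix_eq matrix_vector_mul_assoc[symmetric] matrix_vector_mult_scaleR
        scaleR_matrix_vector_assoc[symmetric] power2_eq_square)
  then have "R = c *\<^sub>R matrix_inv S"
    unfolding R_def using S c by (intro matrix_sqrt_eqI pos_def_scaleR pos_def_matrix_inv)
  then have "R *v (S *v x) = c *\<^sub>R x" for x
    by (simp add: scaleR_matrix_vector_assoc[symmetric] Si)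
  moreover have "invertible R"
    using matrix_sqrt_props[OF A] by (simp add: R_def pos_def_invertible)
  ultimately have "S *v x = c *\<^sub>R (matrix_inv R *v x)" for x
    by (metis matrix_inv_mult_vector(2) matrix_vector_mult_scaleR)
  then show "S = c *\<^sub>R matrix_inv (matrix_sqrt A)"
    by (simp add: matrix_eq scaleR_matrix_vector_assoc[symmetric] R_def)
next
  define R where "R = matrix_sqrt A"
  have R: "invertible R" "R ** R = A"
    using matrix_sqrt_props[OF A] by (simp_all add: R_def pos_def_invertible)
  have A_eq: "A *v x = R *v (R *v x)" for x
    by (simp add: R matrix_vector_mul_assoc)
  assume "S = c *\<^sub>R matrix_inv (matrix_sqrt A)"
  then show "S ** A ** S = c\<^sup>2 *\<^sub>R mat 1"
    by (simp add: matrix_eq matrix_vector_mul_assoc[symmetric] matrix_vector_mult_scaleR A_eq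
        scaleR_matrix_vector_assoc[symmetric] power2_eq_square R_def[symmetric]
        matrix_inv_mult_vector[OF R(1)])
qed

section \<open>Block matrices\<close>

lemma event_eq_iff: "event t x = event t' x' \<longleftrightarrow> t = t' \<and> x = x'"
  by (auto simp: event_def vec_eq_iff split_option_all split: option.splits)

lemma event_time_space: "event (time_part z) (space_part z) = z"
  by (simp add: vec_eq_iff event_def time_part_def space_part_def split: option.split)

text \<open>Every space-time vector is an event, so matrix identities can be checked with
  \<open>block_mult_event\<close> and its analogues in place of block multiplication.\<close>

lemma matrix_eq_event:
  fixes M N :: "real ^ ('d::finite option) ^ ('d option)"
  shows "M = N \<longleftrightarrow> (\<forall>t x. M *v event t x = N *v event t x)"
  by (metis event_time_space matrix_eq)

lemma block_eq_iff:
  "block p q r S = block p' q' r' S' \<longleftrightarrow> p = p' \<and> q = q' \<and> r = r' \<and> S = S'"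
  by (auto simp: block_def vec_eq_iff split_option_all)

lemma transpose_block: "transpose (block p q r S) = block p r q (transpose S)"
  by (simp add: vec_eq_iff transpose_def block_def split: option.split)

lemma block_Qmat_congruence_iff:
  fixes v q :: "real ^ 'd"
  assumes A: "pos_def (C - outer v)" and c: "0 < c"
    and S: "pos_def S" and p: "0 < p"
  defines "A \<equiv> C - outer v"
  shows "block p q 0 S ** Qmat v C ** transpose (block p q 0 S) = Qstar c \<longleftrightarrow>
    S ** A ** S = c\<^sup>2 *\<^sub>R mat 1 \<and> A *v q = p *\<^sub>R v \<and> p\<^sup>2 + p * (q \<bullet> v) = 1"
proof -
  have Q: "Qmat v C = block 1 v v (- A)"
    by (simp add: Qmat_def A_def)
  have symA: "transpose A = A" and symS: "transpose S = S"
    using A S by (simp_all add: A_def pos_def_sym)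
  have neg: "- A *v x = - (A *v x)" for x
    by (simp add: vec_eq_iff matrix_vector_mult_def sum_negf)
  \<comment> \<open>The upper left entry is \<open>p^2 + 2 p (q . v) - q . A q\<close>, arranged so
    that its last summand vanishes together with the off-diagonal block \<open>b\<close>.\<close>
  define a where "a = p\<^sup>2 + p * (q \<bullet> v) + (p *\<^sub>R v - A *v q) \<bullet> q"
  define b where "b = S *v (p *\<^sub>R v - A *v q)"
  have SAS: "- (S ** A ** S) *v x = - (S *v (A *v (S *v x)))" for x
    by (simp add: vec_eq_iff matrix_vector_mul_assoc matrix_mul_assoc)
       (simp add: matrix_vector_mult_def sum_negf)
  have "block p q 0 S ** Qmat v C ** transpose (block p q 0 S) = block a b b (- (S ** A ** S))"
    unfolding matrix_eq_event Q transpose_block symS SAS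
      matrix_vector_mul_assoc[symmetric] block_mult_event event_eq_iff
    by (intro allI conjI)
      (simp_all add: a_def b_def matrix_vector_mult_scaleR matrix_vector_right_distrib
        matrix_vector_mult_diff_distrib symmetric_inner_swap[OF symS]
        symmetric_inner_swap[OF symA] inner_diff_left inner_diff_right inner_add_left
        inner_add_right inner_commute[of q v] power2_eq_square neg algebra_simps)
  then have *: "block p q 0 S ** Qmat v C ** transpose (block p q 0 S) = Qstar c \<longleftrightarrow>
      a = 1 \<and> b = 0 \<and> S ** A ** S = c\<^sup>2 *\<^sub>R mat 1"
    by (simp add: Qstar_def block_eq_iff)
  \<comment> \<open>The invertible factor \<open>S\<close> can be cancelled.\<close>
  have "b = 0 \<longleftrightarrow> A *v q = p *\<^sub>R v"
    unfolding b_def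
    by (metis eq_iff_diff_eq_0 matrix_inv_mult_vector(2) matrix_vector_mult_0_right
        pos_def_invertible[OF S])
  then show ?thesis
    unfolding * by (auto simp: a_def)
qed

section \<open>The normal form\<close>

text \<open>Stating the solution as an equivalence yields existence, uniqueness and the closed form
  at once.\<close>

lemma is_w3_iff:
  fixes v :: "real ^ 'd"
  assumes A: "pos_def (C - outer v)" and c: "0 < c"
  defines "A \<equiv> C - outer v"
  defines "p \<equiv> (1 + v \<bullet> (matrix_inv A *v v)) powr (- 1 / 2)"
  shows "is_w3 c v C W \<longleftrightarrow>
    W = block p (p *\<^sub>R (matrix_inv A *v v)) 0 (c *\<^sub>R matrix_inv (matrix_sqrt A))"
proof -
  define u where "u = matrix_inv A *v v"
  have pA: "pos_def A"
    using A by (simp add: A_def)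
  note iA = matrix_inv_mult_vector[OF pos_def_invertible[OF pA]]
  have pos: "0 < 1 + v \<bullet> u"
    using pos_def_nonneg[OF pos_def_matrix_inv[OF pA], of v] by (simp add: u_def)
  have p: "0 < p" "p\<^sup>2 * (1 + v \<bullet> u) = 1"
  proof -
    show "0 < p"
      using pos by (simp add: p_def u_def)
    have "p\<^sup>2 = (1 + v \<bullet> u) powr (- 1)"
      by (simp add: p_def u_def power2_eq_square powr_add[symmetric])
    then show "p\<^sup>2 * (1 + v \<bullet> u) = 1"
      using pos by (simp add: powr_minus)
  qed
  have q_iff: "A *v q = r *\<^sub>R v \<longleftrightarrow> q = r *\<^sub>R u" for q r
    unfolding u_def by (metis iA matrix_vector_mult_scaleR)
  \<comment> \<open>With \<open>q\<close> eliminated, the last equation fixes the square of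
    \<open>r\<close>, and positivity selects the root.\<close>
  have p_iff: "r\<^sup>2 + r * (r *\<^sub>R u \<bullet> v) = 1 \<longleftrightarrow> r = p" if "0 < r" for r
  proof -
    have "r\<^sup>2 + r * (r *\<^sub>R u \<bullet> v) = r\<^sup>2 * (1 + v \<bullet> u)"
      by (simp add: power2_eq_square algebra_simps inner_commute)
    then have "r\<^sup>2 + r * (r *\<^sub>R u \<bullet> v) = 1 \<longleftrightarrow> r\<^sup>2 * (1 + v \<bullet> u) = p\<^sup>2 * (1 + v \<bullet> u)"
      by (simp add: p(2))
    also have "\<dots> \<longleftrightarrow> r = p"
      using pos that p(1) by (auto simp: power2_eq_iff_nonneg)
    finally show ?thesis .
  qed
  have R: "pos_def (c *\<^sub>R matrix_inv (matrix_sqrt A))"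
    using c by (intro pos_def_scaleR pos_def_matrix_inv matrix_sqrt_props pA)
  have *: "block r q 0 S ** Qmat v C ** transpose (block r q 0 S) = Qstar c \<longleftrightarrow>
      r = p \<and> q = p *\<^sub>R u \<and> S = c *\<^sub>R matrix_inv (matrix_sqrt A)"
    if "0 < r" "pos_def S" for r q S
    using block_Qmat_congruence_iff[OF A c that(2,1), folded A_def, of q]
      pos_def_congruence_mat_iff[OF pA that(2) c] p_iff[OF that(1)] q_iff by auto
  show ?thesis
    unfolding is_w3_def u_def[symmetric] using * p(1) R by auto
qed

text \<open>Uniqueness identifies any verified candidate with \<open>w3\<close>; this serves both
  the closed form and \<open>w_transf\<close>.\<close>

lemma w3_eqI:
  assumes "pos_def (C - outer v)" "0 < c" "is_w3 c v C W"
  shows "w3 c v C = W"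
  unfolding w3_def using assms is_w3_iff[OF assms(1,2)] by (intro the_equality) auto

section \<open>The classical medium\<close>

lemma outer_mult_vector: "outer v *v x = (v \<bullet> x) *\<^sub>R v"
  by (simp add: vec_eq_iff matrix_vector_mult_def outer_nth inner_vec_def sum_distrib_left
      mult_ac)

text \<open>Cauchy-Schwarz bounds the contribution of \<open>outer v\<close> by
  \<open>|v|^2 |x|^2\<close>, which is below \<open>c^2 |x|^2\<close> for nonzero
  \<open>x\<close>.\<close>

lemma classical_admissible:
  fixes v :: "real ^ 'd"
  assumes "norm v < c"
  shows "admissible v (c\<^sup>2 *\<^sub>R mat 1)"
proof -
  have "0 < x \<bullet> ((c\<^sup>2 *\<^sub>R mat 1 - outer v) *v x)" if "x \<noteq> 0" for x
  proof -
    have "(v \<bullet> x)\<^sup>2 \<le> (norm v)\<^sup>2 * (norm x)\<^sup>2"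
      using Cauchy_Schwarz_ineq[of v x] by (simp add: power2_norm_eq_inner)
    also have "\<dots> < c\<^sup>2 * (norm x)\<^sup>2"
      using that assms by (simp add: power_strict_mono)
    finally show ?thesis
      by (simp add: matrix_vector_mult_diff_rdistrib scaleR_matrix_vector_assoc[symmetric]
          outer_mult_vector inner_diff_right dot_square_norm power2_eq_square inner_commute)
  qed
  then show ?thesis
    by (simp add: admissible_def pos_def_def vec_eq_iff transpose_def outer_nth mat_def mult.commute)
qed

text \<open>Trades the real power for an algebraic identity. The bound by 1 makes
  \<open>\<gamma> - 1\<close> nonnegative, hence the space block of \<open>w_transf\<close>
  positive.\<close>

lemma gamma_factor_props:
  fixes v :: "real ^ 'd"
  assumes "norm v < c"
  defines "\<gamma> \<equiv> gamma_factor c v"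
  shows "1 \<le> \<gamma>" "\<gamma>\<^sup>2 * (1 - (norm v)\<^sup>2 / c\<^sup>2) = 1"
proof -
  define b where "b = 1 - (norm v)\<^sup>2 / c\<^sup>2"
  have c: "0 < c"
    using assms by (meson norm_ge_zero order_le_less_trans)
  have "(norm v)\<^sup>2 < c\<^sup>2"
    using assms by (simp add: power_strict_mono)
  then have b: "0 < b" "b \<le> 1"
    using c by (simp_all add: b_def)
  have \<gamma>: "\<gamma> = b powr (- 1 / 2)"
    by (simp add: \<gamma>_def gamma_factor_def b_def)
  show "1 \<le> \<gamma>"
    using b by (simp add: \<gamma> powr_minus one_le_inverse_iff powr_le1)
  have "\<gamma>\<^sup>2 = b powr (- 1)"
    by (simp add: \<gamma> power2_eq_square powr_add[symmetric])
  then show "\<gamma>\<^sup>2 * (1 - (norm v)\<^sup>2 / c\<^sup>2) = 1"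
    using b by (simp add: b_def[symmetric] powr_minus)
qed

lemma norm_scaleR_sgn: "norm v *\<^sub>R sgn v = (v :: 'a :: real_normed_vector)"
  by (cases "v = 0") (simp_all add: sgn_div_norm)

text \<open>The lower left block vanishes because \<open>galilei v\<close> moves the line
  \<open>x = 0\<close> to \<open>x = - t v\<close>, which the boost with velocity \<open>- v\<close>
  brings back to \<open>x = 0\<close>.\<close>

lemma w_transf_block:
  fixes v :: "real ^ 'd"
  assumes "norm v < c"
  defines "\<gamma> \<equiv> gamma_factor c v"
  shows "w_transf c v = block (1 / \<gamma>) ((\<gamma> / c\<^sup>2) *\<^sub>R v) 0 (mat 1 + (\<gamma> - 1) *\<^sub>R outer (sgn v))"
proof -
  have \<gamma>: "0 < \<gamma>" "\<gamma>\<^sup>2 * (1 - (norm v)\<^sup>2 / c\<^sup>2) = 1"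
    using gamma_factor_props[OF assms(1)] by (simp_all add: \<gamma>_def)
  \<comment> \<open>The right hand side is the form in which the coefficient of \<open>t\<close>
    arises.\<close>
  then have inv\<gamma>: "1 / \<gamma> = \<gamma> * (1 - (norm v)\<^sup>2 / c\<^sup>2)"
    by (simp add: field_simps power2_eq_square)
  have neg: "gamma_factor c (- v) = \<gamma>"
    by (simp add: \<gamma>_def gamma_factor_def)
  \<comment> \<open>For \<open>v = 0\<close> both sides vanish since
    \<open>sgn 0 = 0\<close>.\<close>
  have dec: "(sgn v \<bullet> v) *\<^sub>R sgn v = v"
    by (cases "v = 0") (simp_all add: sgn_div_norm dot_square_norm power2_eq_square mult.assoc)
  have time: "\<gamma> * (t - (- v \<bullet> (x - t *\<^sub>R v)) / c\<^sup>2) = 1 / \<gamma> * t + ((\<gamma> / c\<^sup>2) *\<^sub>R v) \<bullet> x" for t x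
    unfolding inv\<gamma>
    by (simp add: inner_diff_right dot_square_norm algebra_simps diff_divide_distrib)
  have space: "x - t *\<^sub>R v + ((\<gamma> - 1) * (sgn (- v) \<bullet> (x - t *\<^sub>R v))) *\<^sub>R sgn (- v) - (\<gamma> * t) *\<^sub>R (- v)
      = x + ((\<gamma> - 1) * (sgn v \<bullet> x)) *\<^sub>R sgn v" for t x
  proof -
    have "((\<gamma> - 1) * (sgn (- v) \<bullet> (x - t *\<^sub>R v))) *\<^sub>R sgn (- v)
        = ((\<gamma> - 1) * (sgn v \<bullet> x)) *\<^sub>R sgn v - ((\<gamma> - 1) * t) *\<^sub>R ((sgn v \<bullet> v) *\<^sub>R sgn v)"
      by (simp add: sgn_minus inner_diff_right algebra_simps)
    then show ?thesis
      unfolding dec by (simp add: algebra_simps)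
  qed
  show ?thesis
    unfolding matrix_eq_event w_transf_def matrix_vector_mul_assoc[symmetric]
      galilei_mult_event lorentz_mult_event block_mult_event neg time space
    by (simp add: matrix_vector_mult_add_rdistrib scaleR_matrix_vector_assoc[symmetric]
        outer_mult_vector)
qed

text \<open>Checking the defining equations directly bypasses computing the inverse square root of
  \<open>A\<close>.\<close>

lemma is_w3_w_transf:
  fixes v :: "real ^ 'd"
  assumes "norm v < c"
  shows "is_w3 c v (c\<^sup>2 *\<^sub>R mat 1) (w_transf c v)"
proof -
  define \<gamma> where "\<gamma> = gamma_factor c v"
  define n where "n = sgn v"
  define a where "a = \<gamma> - 1"
  define S where "S = mat 1 + a *\<^sub>R outer n"
  define A where "A = c\<^sup>2 *\<^sub>R mat 1 - outer v"
  have c: "0 < c"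
    using assms by (meson norm_ge_zero order_le_less_trans)
  have \<gamma>: "1 \<le> \<gamma>" "\<gamma>\<^sup>2 * (1 - (norm v)\<^sup>2 / c\<^sup>2) = 1"
    using gamma_factor_props[OF assms] by (simp_all add: \<gamma>_def)
  then have \<gamma>c: "\<gamma>\<^sup>2 * (c\<^sup>2 - (norm v)\<^sup>2) = c\<^sup>2"
    using c by (simp add: field_simps)
  have S_app: "S *v x = x + (a * (n \<bullet> x)) *\<^sub>R n" for x
    by (simp add: S_def matrix_vector_mult_add_rdistrib scaleR_matrix_vector_assoc[symmetric]
        outer_mult_vector)
  have A_app: "A *v x = c\<^sup>2 *\<^sub>R x - (v \<bullet> x) *\<^sub>R v" for x
    by (simp add: A_def matrix_vector_mult_diff_rdistrib scaleR_matrix_vector_assoc[symmetric]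
        outer_mult_vector)
  have "pos_def S"
    unfolding pos_def_def
  proof (intro conjI allI impI transpose_eq_selfI)
    fix x y :: "real ^ 'd"
    show "(S *v x) \<bullet> y = x \<bullet> (S *v y)"
      by (simp add: S_app inner_add_left inner_add_right inner_commute)
    assume "x \<noteq> 0"
    then have "0 < x \<bullet> x + a * (n \<bullet> x)\<^sup>2"
      using \<gamma>(1) by (simp add: a_def add_pos_nonneg)
    then show "0 < x \<bullet> (S *v x)"
      by (simp add: S_app inner_add_right inner_commute power2_eq_square)
  qed
  moreover have "S ** A ** S = c\<^sup>2 *\<^sub>R mat 1"
  proof -
    have v: "v = norm v *\<^sub>R n"
      by (simp add: n_def norm_scaleR_sgn)
    \<comment> \<open>For nonzero \<open>v\<close>, the unit vector \<open>n\<close> is an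
      eigenvector of \<open>S\<close> and of \<open>A\<close>, with eigenvalues
      \<open>\<gamma>\<close> and \<open>c^2 - |v|^2\<close>; orthogonally to \<open>n\<close> they
      act as 1 and \<open>c^2\<close>. For \<open>v = 0\<close>, \<open>n\<close> is 0 and both are
      multiples of the identity.\<close>
    have "S *v (A *v (S *v x)) = c\<^sup>2 *\<^sub>R x" for x
    proof (cases "v = 0")
      case False
      then have n: "n \<bullet> n = 1"
        by (simp add: n_def dot_square_norm norm_sgn)
      have Sn: "S *v n = \<gamma> *\<^sub>R n"
        by (simp add: S_app n a_def algebra_simps)
      have An: "A *v n = (c\<^sup>2 - (norm v)\<^sup>2) *\<^sub>R n"
        by (subst A_app, subst (1 2) v) (simp add: n power2_eq_square algebra_simps)
      have Ax: "A *v x = c\<^sup>2 *\<^sub>R x - ((norm v)\<^sup>2 * (n \<bullet> x)) *\<^sub>R n" for x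
        by (subst A_app, subst (1 2) v) (simp add: power2_eq_square mult_ac)
      have "S *v (A *v (S *v x)) = c\<^sup>2 *\<^sub>R x +
         (c\<^sup>2 * a - \<gamma> * (norm v)\<^sup>2 + a * \<gamma> * (c\<^sup>2 - (norm v)\<^sup>2)) *\<^sub>R (n \<bullet> x) *\<^sub>R n"
        by (simp add: S_app[of x] Ax[of x] matrix_vector_right_distrib matrix_vector_mult_scaleR
            matrix_vector_mult_diff_distrib An Sn) (simp add: S_app a_def algebra_simps)
      \<comment> \<open>The coefficient of the \<open>n\<close> component vanishes by
        \<open>\<gamma>c\<close>.\<close>
      also have "c\<^sup>2 * a - \<gamma> * (norm v)\<^sup>2 + a * \<gamma> * (c\<^sup>2 - (norm v)\<^sup>2)
          = \<gamma>\<^sup>2 * (c\<^sup>2 - (norm v)\<^sup>2) - c\<^sup>2"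
        by (simp add: a_def power2_eq_square algebra_simps)
      finally show ?thesis
        by (simp add: \<gamma>c)
    qed (simp add: S_app A_app n_def)
    then show ?thesis
      by (simp add: matrix_eq matrix_vector_mul_assoc[symmetric] scaleR_matrix_vector_assoc[symmetric])
  qed
  moreover have "A *v ((\<gamma> / c\<^sup>2) *\<^sub>R v) = (1 / \<gamma>) *\<^sub>R v"
  proof -
    have "A *v ((\<gamma> / c\<^sup>2) *\<^sub>R v) = (\<gamma> / c\<^sup>2 * (c\<^sup>2 - (norm v)\<^sup>2)) *\<^sub>R v"
      by (simp add: A_app matrix_vector_mult_scaleR dot_square_norm algebra_simps)
    also have "\<gamma> / c\<^sup>2 * (c\<^sup>2 - (norm v)\<^sup>2) = 1 / \<gamma>"
      using \<gamma>c \<gamma>(1) c by (simp add: field_simps power2_eq_square)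
    finally show ?thesis .
  qed
  moreover have "(1 / \<gamma>)\<^sup>2 + 1 / \<gamma> * ((\<gamma> / c\<^sup>2) *\<^sub>R v \<bullet> v) = 1"
  proof -
    have "(1 / \<gamma>)\<^sup>2 = 1 - (norm v)\<^sup>2 / c\<^sup>2"
      using \<gamma> by (simp add: field_simps)
    then show ?thesis
      using \<gamma>(1) by (simp add: dot_square_norm)
  qed
  moreover have "pos_def (c\<^sup>2 *\<^sub>R mat 1 - outer v)"
    using classical_admissible[OF assms] by (simp add: admissible_def)
  moreover have "w_transf c v = block (1 / \<gamma>) ((\<gamma> / c\<^sup>2) *\<^sub>R v) 0 S"
    using w_transf_block[OF assms] by (simp add: S_def a_def n_def \<gamma>_def)
  moreover have "0 < 1 / \<gamma>"
    using \<gamma>(1) by simp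
  ultimately show ?thesis
    unfolding is_w3_def using block_Qmat_congruence_iff[of "c\<^sup>2 *\<^sub>R mat 1" v c S "1 / \<gamma>"] c
    by (metis A_def)
qed

theorem proposition17:
  fixes c :: real
  assumes "c > 0" and "CARD('d::finite) \<in> {2, 3}"
  shows "(\<forall>(v :: real ^ 'd) C A. admissible v C \<and> A = C - outer v \<longrightarrow>
            (\<exists>!W. is_w3 c v C W) \<and>
            (\<exists>p q S. w3 c v C = block p q 0 S \<and>
               S = c *\<^sub>R matrix_inv (matrix_sqrt A) \<and>
               q = p *\<^sub>R (matrix_inv A *v v) \<and>
               p = (1 + v \<bullet> (matrix_inv A *v v)) powr (- 1 / 2))) \<and>
         (\<forall>v :: real ^ 'd. norm v < c \<longrightarrow>
            admissible v (c\<^sup>2 *\<^sub>R mat 1) \<and> w3 c v (c\<^sup>2 *\<^sub>R mat 1) = w_transf c v)"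
proof (intro conjI allI impI)
  fix v :: "real ^ 'd" and C A :: "real ^ 'd ^ 'd"
  assume *: "admissible v C \<and> A = C - outer v"
  then have pd: "pos_def (C - outer v)"
    by (simp add: admissible_def)
  note iff = is_w3_iff[OF pd \<open>c > 0\<close>]
  show "\<exists>!W. is_w3 c v C W"
    by (simp add: iff)
  have "w3 c v C = block ((1 + v \<bullet> (matrix_inv A *v v)) powr (- 1 / 2))
      ((1 + v \<bullet> (matrix_inv A *v v)) powr (- 1 / 2) *\<^sub>R (matrix_inv A *v v)) 0
      (c *\<^sub>R matrix_inv (matrix_sqrt A))"
    using * by (intro w3_eqI[OF pd \<open>c > 0\<close>]) (simp add: iff)
  then show "\<exists>p q S. w3 c v C = block p q 0 S \<and>
               S = c *\<^sub>R matrix_inv (matrix_sqrt A) \<and>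
               q = p *\<^sub>R (matrix_inv A *v v) \<and>
               p = (1 + v \<bullet> (matrix_inv A *v v)) powr (- 1 / 2)"
    by blast
next
  fix v :: "real ^ 'd"
  assume v: "norm v < c"
  show adm: "admissible v (c\<^sup>2 *\<^sub>R mat 1)"
    by (rule classical_admissible[OF v])
  show "w3 c v (c\<^sup>2 *\<^sub>R mat 1) = w_transf c v"
    using adm by (intro w3_eqI is_w3_w_transf[OF v] \<open>c > 0\<close>) (simp add: admissible_def)
qed

end
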